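(* Let $S$ be a discrete abelian cancellative semigroup with unit $e$. If $S$ contains no nontrivial prime ideals, then the strong boundary $\Gamma$ and the Shilov boundary $\partial_{A(\widehat S)}$ of the uniform algebra $A(\widehat S)$ satisfy $$\Gamma=\partial_{A(\widehat S)}=X.$$
   Context: $S$ is a discrete abelian cancellative semigroup with unit $e$, written multiplicatively. A semicharacter of $S$ is a homomorphism $\psi$ from $S$ to the multiplicative semigroup $\overline{\mathbb D}=\{z\in\mathbb C:|z|\le 1\}$ that is not identically zero. $\widehat S$ is the set of all semicharacters with pointwise multiplication and the topology of pointwise convergence on $S$; it is a compact topological semigroup with unit $1$ (the constant function). $X\subseteq\widehat S$ is the compact group of characters (semicharacters of modulus $1$ everywhere). For a nonnegative semicharacter $\rho$ and $\mathrm{Re}\,z>0$, $\rho^z(s)=\rho(s)^z$ (with $0^z=0$), and $\rho^0$ is the indicator function of $\{s:\rho(s)>0\}$. A function $F:\widehat S\setminus X\to\mathbb C$ is generalized analytic if for all $\rho,\psi\in\widehat S\setminus X$ with $\rho\ge 0$ the map $z\mapsto F(\rho^z\psi)$ is analytic in the open right half-plane $\{\mathrm{Re}\,z>0\}$ and continuous at $+0$. $A(\widehat S)$ is the uniform algebra (sup norm) of all continuous functions on $\widehat S$ whose restriction to $\widehat S\setminus X$ is generalized analytic. The strong boundary of a uniform algebra $A$ on a compact space $Y$ is the set of its $p$-points, i.e. of the points $y\in Y$ such that $\{y\}$ is an intersection of peak sets of $A$. The Shilov boundary is taken as a subset of $\widehat S$ (the smallest closed subset on which every function of the algebra attains its maximum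 modulus). A (nonempty) ideal of $S$ is called prime (the paper: "simple") if its complement in $S$ is a (nonempty) subsemigroup; a prime ideal is called nontrivial if it is different from $S\setminus\{e\}$. *)

theory Defs
  imports "HOL-Analysis.Analysis"
begin

text \<open>
  The semigroup is a type \<open>'a\<close> of class \<open>comm_monoid_mult\<close> with unit \<open>1\<close>; cancellation is an
  explicit hypothesis, since the library has no multiplicative class for it.
\<close>

definition semigroup_ideal :: "'a::comm_monoid_mult set \<Rightarrow> bool" where
  "semigroup_ideal I \<longleftrightarrow> I \<noteq> {} \<and> (\<forall>s. \<forall>i\<in>I. s * i \<in> I)"

definition subsemigroup :: "'a::comm_monoid_mult set \<Rightarrow> bool" where
  "subsemigroup T \<longleftrightarrow> T \<noteq> {} \<and> (\<forall>s\<in>T. \<forall>t\<in>T. s * t \<in> T)"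

definition prime_ideal :: "'a::comm_monoid_mult set \<Rightarrow> bool" where
  "prime_ideal I \<longleftrightarrow> semigroup_ideal I \<and> subsemigroup (- I)"

definition nontrivial_prime_ideal :: "'a::comm_monoid_mult set \<Rightarrow> bool" where
  "nontrivial_prime_ideal I \<longleftrightarrow> prime_ideal I \<and> I \<noteq> UNIV - {1}"


text \<open>
  Semicharacters live in the function space \<open>'a \<Rightarrow> complex\<close>, whose library topology is the product
  topology, so its subspace topology on \<open>semicharacters\<close> is that of pointwise convergence.
\<close>

definition semicharacters :: "('a::comm_monoid_mult \<Rightarrow> complex) set" where
  "semicharacters = {\<psi>. (\<forall>s. \<psi> s \<in> cball 0 1) \<and> (\<forall>s t. \<psi> (s * t) = \<psi> s * \<psi> t) \<and> (\<exists>s. \<psi> s \<noteq> 0)}"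

definition characters :: "('a::comm_monoid_mult \<Rightarrow> complex) set" where
  "characters = {\<psi> \<in> semicharacters. \<forall>s. cmod (\<psi> s) = 1}"

definition nonneg_semicharacter :: "('a::comm_monoid_mult \<Rightarrow> complex) \<Rightarrow> bool" where
  "nonneg_semicharacter \<rho> \<longleftrightarrow> \<rho> \<in> semicharacters \<and> (\<forall>s. \<rho> s \<in> \<real>\<^sub>\<ge>\<^sub>0)"

text \<open>
  The library's \<open>powr\<close> satisfies \<open>0 powr z = 0\<close> for all \<open>z\<close> and \<open>x powr 0 = 1\<close> for \<open>x \<noteq> 0\<close>, so
  this covers both \<open>Re z > 0\<close> and \<open>z = 0\<close>; see \<open>semichar_power_0\<close>.
\<close>

definition semichar_power :: "('a \<Rightarrow> complex) \<Rightarrow> complex \<Rightarrow> 'a \<Rightarrow> complex" where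
  "semichar_power \<rho> z = (\<lambda>s. \<rho> s powr z)"

lemma semichar_power_0: "semichar_power \<rho> 0 = (\<lambda>s. if \<rho> s \<noteq> 0 then 1 else 0)"
  by (auto simp: semichar_power_def)

text \<open>
  Only the values of \<open>F\<close> on \<open>semicharacters - characters\<close> matter, by the following closure
  property.
\<close>

lemma semichar_power_mult_closed:
  assumes \<rho>: "nonneg_semicharacter \<rho>" and \<psi>: "\<psi> \<in> semicharacters - characters"
    and z: "z = 0 \<or> 0 < Re z"
  shows "(\<lambda>s. semichar_power \<rho> z s * \<psi> s) \<in> semicharacters - characters"
proof -
  have real: "\<exists>r\<ge>0. \<rho> s = complex_of_real r \<and> r \<le> 1" for s
  proof -
    have "\<rho> s \<in> \<real>\<^sub>\<ge>\<^sub>0" "cmod (\<rho> s) \<le> 1"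
      using \<rho> unfolding nonneg_semicharacter_def semicharacters_def by auto
    then show ?thesis by (auto elim!: nonneg_Reals_cases)
  qed
  have mult: "\<rho> (s * t) = \<rho> s * \<rho> t" for s t
    using \<rho> unfolding nonneg_semicharacter_def semicharacters_def by auto
  have pm: "\<rho> (s * t) powr z = \<rho> s powr z * \<rho> t powr z" for s t
  proof -
    have "\<rho> s \<in> \<real>" "0 \<le> Re (\<rho> s)"
      using real[of s] by auto
    then show ?thesis unfolding mult by (rule powr_times_real_left)
  qed
  have pn: "cmod (\<rho> s powr z) \<le> 1" for s
  proof -
    obtain r where r: "r \<ge> 0" "\<rho> s = complex_of_real r" "r \<le> 1"
      using real[of s] by blast
    have "cmod (\<rho> s powr z) = r powr Re z" if "r > 0"
      using r that by (simp add: norm_powr_real_powr)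
    moreover have "r powr Re z \<le> 1"
      using r z by (auto intro: powr_le1)
    ultimately show ?thesis
      using r by (cases "r = 0") auto
  qed
  have \<rho>1: "\<rho> 1 = 1"
  proof -
    obtain s where "\<rho> s \<noteq> 0"
      using \<rho> unfolding nonneg_semicharacter_def semicharacters_def by blast
    moreover have "\<rho> s = \<rho> s * \<rho> 1" using mult[of s 1] by simp
    ultimately show ?thesis by simp
  qed
  have \<psi>mult: "\<psi> (s * t) = \<psi> s * \<psi> t" for s t
    using \<psi> unfolding semicharacters_def by blast
  have \<psi>1: "\<psi> 1 \<noteq> 0"
  proof -
    obtain s where "\<psi> s \<noteq> 0"
      using \<psi> unfolding semicharacters_def by blast
    then show ?thesis using \<psi>mult[of s 1] by auto
  qed
  have le: "cmod (\<rho> s powr z * \<psi> s) \<le> cmod (\<psi> s)" for s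
    using pn[of s] by (simp add: norm_mult mult_left_le_one_le)
  have \<psi>n: "cmod (\<psi> s) \<le> 1" for s
    using \<psi> unfolding semicharacters_def by simp
  obtain s0 where "cmod (\<psi> s0) \<noteq> 1"
    using \<psi> unfolding characters_def by blast
  then have s0: "cmod (\<psi> s0) < 1" using \<psi>n[of s0] by linarith
  let ?f = "\<lambda>s. semichar_power \<rho> z s * \<psi> s"
  have "cmod (?f s) \<le> 1" for s
    using le[of s] \<psi>n[of s] by (simp add: semichar_power_def)
  moreover have "?f (s * t) = ?f s * ?f t" for s t
    by (simp add: semichar_power_def pm \<psi>mult)
  moreover have "?f 1 \<noteq> 0"
    using \<psi>1 by (simp add: semichar_power_def \<rho>1)
  ultimately have "?f \<in> semicharacters"
    unfolding semicharacters_def mem_Collect_eq mem_cball_0 by blast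
  moreover have "cmod (?f s0) \<noteq> 1"
    using le[of s0] s0 by (simp add: semichar_power_def)
  ultimately show ?thesis
    unfolding characters_def by blast
qed

text \<open>
  Continuity at \<open>+0\<close>: the limit as \<open>z\<close> tends to \<open>0\<close> within the open right half-plane is the
  value at \<open>z = 0\<close>.
\<close>

definition generalized_analytic :: "(('a::comm_monoid_mult \<Rightarrow> complex) \<Rightarrow> complex) \<Rightarrow> bool" where
  "generalized_analytic F \<longleftrightarrow>
    (\<forall>\<rho> \<in> semicharacters - characters. \<forall>\<psi> \<in> semicharacters - characters.
      nonneg_semicharacter \<rho> \<longrightarrow>
        (\<lambda>z. F (\<lambda>s. semichar_power \<rho> z s * \<psi> s)) analytic_on {z. 0 < Re z} \<and>
        ((\<lambda>z. F (\<lambda>s. semichar_power \<rho> z s * \<psi> s))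
           \<longlongrightarrow> F (\<lambda>s. semichar_power \<rho> 0 s * \<psi> s)) (at 0 within {z. 0 < Re z}))"

text \<open>
  Elements of the algebra are represented by total functions, of which only the values on
  \<open>semicharacters\<close> are relevant.
\<close>

definition A_hat :: "(('a::comm_monoid_mult \<Rightarrow> complex) \<Rightarrow> complex) set" where
  "A_hat = {F. continuous_on semicharacters F \<and> generalized_analytic F}"


text \<open>Boundaries of an algebra \<open>A\<close> of continuous functions on a compact space \<open>Y\<close>.\<close>

definition peak_set :: "('b \<Rightarrow> complex) set \<Rightarrow> 'b set \<Rightarrow> 'b set \<Rightarrow> bool" where
  "peak_set A Y E \<longleftrightarrow>
    E \<noteq> {} \<and> E \<subseteq> Y \<and> (\<exists>f\<in>A. (\<forall>y\<in>E. f y = 1) \<and> (\<forall>y\<in>Y - E. cmod (f y) < 1))"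

definition p_point :: "('b \<Rightarrow> complex) set \<Rightarrow> 'b set \<Rightarrow> 'b \<Rightarrow> bool" where
  "p_point A Y y \<longleftrightarrow> (\<exists>P. P \<noteq> {} \<and> (\<forall>E\<in>P. peak_set A Y E) \<and> \<Inter>P = {y})"

definition strong_boundary :: "('b \<Rightarrow> complex) set \<Rightarrow> 'b set \<Rightarrow> 'b set" where
  "strong_boundary A Y = {y \<in> Y. p_point A Y y}"

definition closed_boundary ::
    "('b::topological_space \<Rightarrow> complex) set \<Rightarrow> 'b set \<Rightarrow> 'b set \<Rightarrow> bool" where
  "closed_boundary A Y E \<longleftrightarrow>
    closedin (top_of_set Y) E \<and> (\<forall>f\<in>A. \<exists>y\<in>E. \<forall>x\<in>Y. cmod (f x) \<le> cmod (f y))"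

text \<open>
  A predicate rather than a set-valued function, so that the existence of the smallest closed
  boundary is part of the assertion that \<open>E\<close> is the Shilov boundary.
\<close>

definition is_shilov_boundary ::
    "('b::topological_space \<Rightarrow> complex) set \<Rightarrow> 'b set \<Rightarrow> 'b set \<Rightarrow> bool" where
  "is_shilov_boundary A Y E \<longleftrightarrow>
    closed_boundary A Y E \<and> (\<forall>E'. closed_boundary A Y E' \<longrightarrow> E \<subseteq> E')"

end

theory Submission
  imports Defs "HOL-Complex_Analysis.Conformal_Mappings"
begin

text \<open>
  A nowhere vanishing semicharacter is \<open>\<psi> = \<bar>\<psi>\<bar> \<sigma>\<close> with \<open>\<sigma>\<close> a character, and \<open>z \<mapsto> F (\<bar>\<psi>\<bar>\<^sup>z \<sigma>)\<close> is a
  bounded analytic function on the right half-plane whose values on the imaginary axis are values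
  of \<open>F\<close> at characters; so the maximum principle bounds \<open>F \<psi>\<close> by \<open>F\<close> on the characters. The zero
  set of any other semicharacter is a prime ideal, hence the semicharacter is the indicator of the
  unit. Then every non-unit \<open>a\<close> is an order unit for divisibility, and Zorn's lemma gives an additive
  \<open>p \<ge> 0\<close> with \<open>p a = 1\<close>; again by triviality of prime ideals \<open>p\<close> vanishes only at the unit, so that
  the nowhere vanishing \<open>exp (- n p)\<close> converge to the indicator. Conversely
  \<open>(1 + cnj (\<sigma> s) \<psi> s) / 2\<close> peaks exactly where \<open>\<psi> s = \<sigma> s\<close>, which makes each character \<open>\<sigma>\<close> a
  \<open>p\<close>-point, and by compactness a \<open>p\<close>-point belongs to every closed boundary.
\<close>

section \<open>Boundaries of algebras of continuous functions\<close>

lemma peak_set_eq: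
  assumes "peak_set A Y E"
  obtains f where "f \<in> A" "E = {y \<in> Y. f y = 1}" "\<And>y. y \<in> Y \<Longrightarrow> cmod (f y) \<le> 1"
    "\<And>y. y \<in> Y \<Longrightarrow> 1 \<le> cmod (f y) \<Longrightarrow> y \<in> E"
proof -
  obtain f where f: "f \<in> A" "E \<subseteq> Y" "\<forall>y\<in>E. f y = 1" "\<forall>y\<in>Y - E. cmod (f y) < 1"
    using assms unfolding peak_set_def by blast
  have "cmod (f y) \<le> 1" "1 \<le> cmod (f y) \<Longrightarrow> y \<in> E" if "y \<in> Y" for y
    using f that by (cases "y \<in> E"; force)+
  moreover have "E = {y \<in> Y. f y = 1}"
    using f by (auto, metis DiffI less_irrefl norm_one)
  ultimately show thesis
    using that f(1) by blast
qed

text \<open>The product of the peaking functions takes the value 1 at \<open>y\<close>, is bounded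
  by 1 on \<open>Y\<close>, and reaches modulus 1 only on \<open>\<Inter>P\<close>. A point of
  \<open>E\<close> where its modulus is maximal therefore lies in \<open>\<Inter>P\<close>.\<close>

lemma finite_peak_sets_meet_boundary:
  assumes one: "(\<lambda>_. 1) \<in> A"
    and mult: "\<And>f g. f \<in> A \<Longrightarrow> g \<in> A \<Longrightarrow> (\<lambda>y. f y * g y) \<in> A"
    and E: "closed_boundary A Y E"
    and P: "finite P" "\<And>K. K \<in> P \<Longrightarrow> peak_set A Y K" "y \<in> Y" "y \<in> \<Inter>P"
  shows "E \<inter> \<Inter>P \<noteq> {}"
proof -
  have "\<exists>f\<in>A. f y = 1 \<and> (\<forall>x\<in>Y. cmod (f x) \<le> 1 \<and> (1 \<le> cmod (f x) \<longrightarrow> x \<in> \<Inter>P))"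
    using P
  proof (induction P rule: finite_induct)
    case empty
    show ?case using one by (intro bexI[of _ "\<lambda>_. 1"]) auto
  next
    case (insert K P)
    obtain f where f: "f \<in> A" "f y = 1"
        "\<And>x. x \<in> Y \<Longrightarrow> cmod (f x) \<le> 1" "\<And>x. x \<in> Y \<Longrightarrow> 1 \<le> cmod (f x) \<Longrightarrow> x \<in> \<Inter>P"
      using insert by (metis Inter_iff insertCI)
    obtain g where g: "g \<in> A" "K = {y \<in> Y. g y = 1}" "\<And>x. x \<in> Y \<Longrightarrow> cmod (g x) \<le> 1"
        "\<And>x. x \<in> Y \<Longrightarrow> 1 \<le> cmod (g x) \<Longrightarrow> x \<in> K"
      using peak_set_eq[of A Y K] insert.prems by auto
    have "g y = 1"
      using g(2) insert.prems by auto
    moreover have "cmod (f x * g x) \<le> 1" if "x \<in> Y" for x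
      using f(3) g(3) that by (simp add: norm_mult mult_le_one)
    moreover have "x \<in> \<Inter>(insert K P)" if x: "x \<in> Y" "1 \<le> cmod (f x * g x)" for x
    proof -
      have "cmod (f x * g x) \<le> cmod (f x)" "cmod (f x * g x) \<le> cmod (g x)"
        using f(3) g(3) x(1) by (simp_all add: norm_mult mult_left_le mult_left_le_one_le)
      then show ?thesis
        using f(4) g(4) x by (metis Inter_insert IntI order_trans)
    qed
    ultimately show ?case
      using mult[OF f(1) g(1)] f(2) by (intro bexI[of _ "\<lambda>x. f x * g x"]) auto
  qed
  then obtain f where f: "f \<in> A" "f y = 1" "\<And>x. x \<in> Y \<Longrightarrow> 1 \<le> cmod (f x) \<Longrightarrow> x \<in> \<Inter>P"
    by blast
  obtain x where "x \<in> E" "cmod (f y) \<le> cmod (f x)"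
    using E f(1) \<open>y \<in> Y\<close> unfolding closed_boundary_def by blast
  moreover have "E \<subseteq> Y"
    using E unfolding closed_boundary_def by (blast dest: closedin_imp_subset)
  ultimately show ?thesis
    using f by fastforce
qed

text \<open>Peak sets are level sets of continuous functions, hence closed. Any finitely many of
  those that cut out \<open>y\<close> meet the compact set \<open>E\<close>, so by the finite
  intersection property \<open>E\<close> meets \<open>{y}\<close>. Closedness of \<open>Y\<close> is
  assumed beside compactness because the space need not be Hausdorff.\<close>

lemma strong_boundary_subset_closed_boundary:
  fixes Y :: "'b::topological_space set"
  assumes Y: "compact Y" "closed Y"
    and cont: "\<And>f. f \<in> A \<Longrightarrow> continuous_on Y f"
    and one: "(\<lambda>_. 1) \<in> A"
    and mult: "\<And>f g. f \<in> A \<Longrightarrow> g \<in> A \<Longrightarrow> (\<lambda>y. f y * g y) \<in> A"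
    and E: "closed_boundary A Y E"
  shows "strong_boundary A Y \<subseteq> E"
proof
  fix y assume "y \<in> strong_boundary A Y"
  then obtain P where y: "y \<in> Y" and P: "\<And>K. K \<in> P \<Longrightarrow> peak_set A Y K" "\<Inter>P = {y}"
    unfolding strong_boundary_def p_point_def by blast
  have "compact E"
    using E Y(1) unfolding closed_boundary_def by (blast intro: closedin_compact)
  moreover have "closed K" if K: "K \<in> P" for K
  proof -
    obtain f where "f \<in> A" "K = {y \<in> Y. f y = 1}"
      using peak_set_eq[OF P(1)[OF K]] by blast
    then show ?thesis
      using continuous_closed_preimage_constant[OF cont Y(2)] by simp
  qed
  moreover have "E \<inter> \<Inter>Q \<noteq> {}" if "finite Q" "Q \<subseteq> P" for Q
  proof (rule finite_peak_sets_meet_boundary[OF one mult E that(1) _ y])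
    show "y \<in> \<Inter>Q" using P(2) that(2) by auto
  qed (use P(1) that(2) in auto)
  ultimately have "E \<inter> \<Inter>P \<noteq> {}"
    by (rule compact_imp_fip)
  then show "y \<in> E"
    using P(2) by auto
qed

section \<open>A maximum principle for the half-plane\<close>

lemma norm_one_plus_ge:
  fixes z :: complex
  assumes "0 \<le> Re z"
  shows "1 \<le> cmod (1 + z)" "cmod z \<le> cmod (1 + z)"
proof -
  show "1 \<le> cmod (1 + z)"
    using complex_Re_le_cmod[of "1 + z"] assms by simp
  have "(cmod z)\<^sup>2 \<le> (cmod (1 + z))\<^sup>2"
    unfolding cmod_power2 using assms by (simp add: power2_eq_square algebra_simps)
  then show "cmod z \<le> cmod (1 + z)"
    by (rule power2_le_imp_le) simp
qed

text \<open>A Phragmen-Lindelof argument: the global bound \<open>B\<close> controls the function at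
  infinity without entering the conclusion.\<close>

lemma halfplane_maximum_principle:
  assumes hol: "f holomorphic_on {z. 0 < Re z}"
    and cont: "continuous_on {z. 0 \<le> Re z} f"
    and bdd: "\<And>z. 0 \<le> Re z \<Longrightarrow> cmod (f z) \<le> B"
    and axis: "\<And>z. Re z = 0 \<Longrightarrow> cmod (f z) \<le> m"
    and w: "0 < Re w"
  shows "cmod (f w) \<le> m"
proof (rule ccontr)
  assume "\<not> cmod (f w) \<le> m"
  then obtain m' where m': "m < m'" "m' < cmod (f w)"
    using dense not_le by blast
  have "0 \<le> m"
    using order_trans[OF norm_ge_zero axis[of 0]] by simp
  then have "0 < m'" using m' by simp
  then have "1 < cmod (f w) / m'"
    using m' by simp
  then obtain n where n: "cmod (1 + w) < (cmod (f w) / m') ^ n"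
    using real_arch_pow by blast
  \<comment> \<open>The radius depends on \<open>n\<close>: the half disc must contain
    \<open>w\<close>, and on the arc the bound \<open>B ^ n / R\<close> must not exceed
    \<open>m' ^ n\<close>.\<close>
  define R where "R = max (cmod w + 1) (B ^ n / m' ^ n)"
  have R: "cmod w < R" "B ^ n / m' ^ n \<le> R" "0 < R"
    unfolding R_def using norm_ge_zero[of w] by linarith+
  have BR: "B ^ n / R \<le> m' ^ n"
    using R \<open>0 < m'\<close> by (simp add: field_simps)
  \<comment> \<open>The divisor \<open>1 + z\<close> makes the large arc harmless, and the power \<open>n\<close> makes the divisor
    harmless at \<open>w\<close>.\<close>
  define h where "h z = f z ^ n / (1 + z)" for z
  define S where "S = {z. 0 < Re z} \<inter> ball 0 R"
  have S: "open S"
    unfolding S_def by (simp add: open_Int open_halfspace_Re_gt)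
  have "closed ({z. 0 \<le> Re z} \<inter> cball 0 R)"
    by (simp add: closed_Int closed_halfspace_Re_ge)
  then have clS: "closure S \<subseteq> {z. 0 \<le> Re z} \<inter> cball 0 R"
    unfolding S_def by (intro closure_minimal) auto
  have nz: "1 + z \<noteq> 0" if "0 \<le> Re z" for z
    using norm_one_plus_ge(1)[OF that] by auto
  have "cmod (h w) \<le> m' ^ n"
  proof (rule maximum_modulus_frontier[where f = h and S = S])
    show "h holomorphic_on interior S"
      unfolding h_def interior_open[OF S]
      by (intro holomorphic_intros holomorphic_on_subset[OF hol]) (auto simp: S_def intro!: nz)
    show "continuous_on (closure S) h"
      unfolding h_def
      by (intro continuous_intros continuous_on_subset[OF cont]) (use clS nz in auto)
    show "bounded S"
      unfolding S_def by (simp add: bounded_Int)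
    show "w \<in> S"
      using w R unfolding S_def by simp
    fix z assume "z \<in> frontier S"
    then have z: "z \<in> closure S" "z \<notin> S"
      unfolding frontier_def interior_open[OF S] by auto
    then have Re: "0 \<le> Re z" and "cmod z \<le> R"
      using clS by auto
    then consider "Re z = 0" | "cmod z = R"
      using z(2) unfolding S_def by force
    then show "cmod (h z) \<le> m' ^ n"
    proof cases
      case 1
      have "cmod (h z) \<le> cmod (f z) ^ n"
        unfolding h_def norm_divide norm_power
        using norm_one_plus_ge(1)[OF Re] by (simp add: divide_le_eq mult_left_le mult_le_cancel_left1)
      also have "\<dots> \<le> m' ^ n"
        using axis[OF 1] m'(1) by (intro power_mono) auto
      finally show ?thesis .
    next
      case 2
      have "cmod (h z) \<le> B ^ n / R"
        unfolding h_def norm_divide norm_power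
        using norm_one_plus_ge(2)[OF Re] bdd[OF Re] 2 R(3)
        by (intro frac_le power_mono zero_le_power order_trans[OF norm_ge_zero]) auto
      then show ?thesis
        using BR by simp
    qed
  qed
  moreover have "0 < cmod (1 + w)"
    using norm_one_plus_ge(1)[of w] w by linarith
  ultimately have "cmod (f w) ^ n \<le> m' ^ n * cmod (1 + w)"
    unfolding h_def norm_divide norm_power by (simp add: divide_le_eq)
  moreover have "m' ^ n * cmod (1 + w) < cmod (f w) ^ n"
    using n \<open>0 < m'\<close> by (simp add: power_divide field_simps)
  ultimately show False by simp
qed

section \<open>Additive functionals on archimedean monoids\<close>

text \<open>
  A functional on the monoid behaves like a sublinear functional on its group of fractions once
  \<open>p (s * a) = p s + 1\<close> is imposed: this encodes the values \<open>p a = 1\<close> and \<open>p (a\<^sup>-\<^sup>1) = - 1\<close>. As in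
  the proof of the Hahn-Banach theorem, a minimal such functional is additive.
\<close>

definition gauge_like :: "'a::comm_monoid_mult \<Rightarrow> ('a \<Rightarrow> real) \<Rightarrow> bool" where
  "gauge_like a p \<longleftrightarrow>
    (\<forall>s t. p s \<le> p (s * t)) \<and> (\<forall>s t. p (s * t) \<le> p s + p t) \<and>
    (\<forall>s n. p (s ^ n) = real n * p s) \<and> (\<forall>s. p (s * a) = p s + 1)"

lemma gauge_likeD:
  assumes "gauge_like a p"
  shows "p s \<le> p (s * t)" "p (s * t) \<le> p s + p t" "p (s ^ n) = real n * p s"
    "p (s * a) = p s + 1"
  using assms unfolding gauge_like_def by blast+

lemma gauge_like_1: "gauge_like a p \<Longrightarrow> p 1 = 0"
  using gauge_likeD(3)[of a p 1 0] by simp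

lemma gauge_like_nonneg: "gauge_like a p \<Longrightarrow> 0 \<le> p s"
  using gauge_likeD(1)[of a p 1 s] gauge_like_1[of a p] by simp

text \<open>The functional is the gauge of the order unit \<open>a\<close> for divisibility: the
  infimum of the fractions \<open>k / m\<close> with \<open>x ^ m dvd a ^ k\<close>. Cancellation
  and \<open>nonunit\<close> serve to show that multiplying by \<open>a\<close> raises it by at
  least 1.\<close>

lemma gauge_like_exists:
  fixes a :: "'a::comm_monoid_mult"
  assumes cancel: "\<And>a b c :: 'a. a * b = a * c \<Longrightarrow> b = c"
    and arch: "\<And>s. \<exists>n. s dvd a ^ n"
    and nonunit: "\<not> a dvd 1"
  shows "\<exists>p. gauge_like a p"
proof -
  define V where "V x = {real k / real m | k m. 0 < m \<and> x ^ m dvd a ^ k}" for x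
  define p where "p x = Inf (V x)" for x
  have bdd: "bdd_below (V x)" for x
    unfolding V_def by (rule bdd_belowI[of _ 0]) auto
  have le: "p x \<le> real k / real m" if "0 < m" "x ^ m dvd a ^ k" for x k m
    unfolding p_def by (rule cInf_lower[OF _ bdd]) (use that in \<open>auto simp: V_def\<close>)
  have ge: "c \<le> p x" if *: "\<And>k m. 0 < m \<Longrightarrow> x ^ m dvd a ^ k \<Longrightarrow> c \<le> real k / real m" for c x
    unfolding p_def
  proof (rule cInf_greatest)
    obtain k where "x ^ 1 dvd a ^ k" using arch[of x] by auto
    then show "V x \<noteq> {}" unfolding V_def using zero_less_one by blast
  qed (auto simp: V_def intro: *)
  have dvd_cancel: "b dvd c" if "d * b dvd d * c" for b c d :: 'a
  proof -
    obtain u where "d * c = d * (b * u)"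
      using \<open>d * b dvd d * c\<close> by (auto simp: dvd_def mult.assoc)
    then show ?thesis using cancel by (auto simp: dvd_def)
  qed
  have dvd_power_same: "b ^ n dvd c ^ n" if "b dvd c" for b c :: 'a and n
    using that by (auto simp: dvd_def power_mult_distrib)
  have sub: "p (s * t) \<le> p s + p t" for s t
  proof -
    \<comment> \<open>Raising the two divisibilities to the powers \<open>n\<close> and
      \<open>m\<close> gives both the common exponent \<open>m * n\<close>.\<close>
    have *: "p (s * t) \<le> real k / real m + real l / real n"
      if "0 < m" "s ^ m dvd a ^ k" "0 < n" "t ^ n dvd a ^ l" for k l m n
    proof -
      have "(s ^ m) ^ n * (t ^ n) ^ m dvd (a ^ k) ^ n * (a ^ l) ^ m"
        using that by (intro mult_dvd_mono dvd_power_same)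
      then have "(s * t) ^ (m * n) dvd a ^ (k * n + l * m)"
        by (simp add: power_mult_distrib power_add mult.commute flip: power_mult)
      from le[OF _ this] show ?thesis
        using that by (simp add: field_simps)
    qed
    \<comment> \<open>The two infima are taken one after the other, the first fraction being held
      fixed.\<close>
    have "p (s * t) - real k / real m \<le> p t" if "0 < m" "s ^ m dvd a ^ k" for k m
      using *[OF that] by (intro ge) (simp add: algebra_simps)
    then have "p (s * t) - p t \<le> p s"
      by (intro ge) (simp add: algebra_simps)
    then show ?thesis by simp
  qed
  have nonneg: "0 \<le> p s" for s
    by (rule ge) simp
  have mono: "p s \<le> p (s * t)" for s t
    by (rule ge, rule le) (auto simp: power_mult_distrib intro: dvd_mult_left)
  have hom: "p (s ^ n) = real n * p s" for s n
  proof (cases "n = 0")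
    case True
    have "p 1 \<le> 0"
      using le[of 1 1 0] by simp
    then show ?thesis using True nonneg[of 1] by simp
  next
    case False
    then have n: "0 < real n" by simp
    have "p (s ^ n) / real n \<le> p s"
    proof (rule ge)
      fix k m assume m: "0 < m" "s ^ m dvd a ^ k"
      then have "(s ^ n) ^ m dvd a ^ (k * n)"
        using dvd_power_same[OF m(2), of n] by (simp add: mult.commute flip: power_mult)
      from le[OF m(1) this] show "p (s ^ n) / real n \<le> real k / real m"
        using n m(1) by (simp add: field_simps)
    qed
    moreover have "real n * p s \<le> p (s ^ n)"
    proof (rule ge)
      fix k m assume m: "0 < m" "(s ^ n) ^ m dvd a ^ k"
      then have "s ^ (n * m) dvd a ^ k"
        by (simp add: power_mult)
      from le[OF _ this] show "real n * p s \<le> real k / real m"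
        using n m(1) by (simp add: field_simps)
    qed
    ultimately show ?thesis
      using n by (simp add: field_simps)
  qed
  have unit: "p (s * a) = p s + 1" for s
  proof (rule antisym)
    have "p a \<le> 1" using le[of 1 a 1] by simp
    then show "p (s * a) \<le> p s + 1" using sub[of s a] by simp
    show "p s + 1 \<le> p (s * a)"
    proof (rule ge)
      fix k m assume m: "0 < m" "(s * a) ^ m dvd a ^ k"
      \<comment> \<open>Otherwise \<open>a ^ k\<close> cancels and leaves a multiple of
        \<open>a\<close> dividing 1.\<close>
      have "m \<le> k"
      proof (rule ccontr)
        assume "\<not> m \<le> k"
        then have "a ^ m = a ^ k * (a ^ (m - k - 1) * a)"
          by (subst power_Suc2[symmetric], subst power_add[symmetric]) simp
        then have "a ^ k * (s ^ m * a ^ (m - k - 1) * a) dvd a ^ k * 1"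
          using m(2) by (simp add: power_mult_distrib ac_simps)
        then have "a dvd 1"
          by (metis dvd_cancel dvd_mult_right)
        then show False using nonunit by simp
      qed
      then have "a ^ m * s ^ m dvd a ^ m * a ^ (k - m)"
        using m(2) by (simp add: power_mult_distrib mult.commute flip: power_add)
      from le[OF m(1) dvd_cancel[OF this]] show "p s + 1 \<le> real k / real m"
        using m(1) \<open>m \<le> k\<close> by (simp add: field_simps of_nat_diff)
    qed
  qed
  show ?thesis
    unfolding gauge_like_def using mono sub hom unit by blast
qed

text \<open>Three of the conditions concern one functional at a time and pass to the pointwise
  infimum directly. Subadditivity mixes two members of \<open>C\<close>, and there the chain
  supplies a member below both.\<close>

lemma gauge_like_Inf_chain:
  assumes C: "C \<noteq> {}" "\<And>p. p \<in> C \<Longrightarrow> gauge_like a p"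
    and chain: "\<And>p q. p \<in> C \<Longrightarrow> q \<in> C \<Longrightarrow> p \<le> q \<or> q \<le> p"
  shows "gauge_like a (\<lambda>s. INF p\<in>C. p s)"
proof -
  have bdd: "bdd_below ((\<lambda>p. p s) ` C)" for s
    using gauge_like_nonneg[OF C(2)] by (intro bdd_belowI2[of _ 0])
  have le: "(INF p\<in>C. p s) \<le> p s" if "p \<in> C" for p s
    by (rule cINF_lower[OF bdd that])
  have ge: "c \<le> (INF p\<in>C. p s)" if "\<And>p. p \<in> C \<Longrightarrow> c \<le> p s" for c s
    by (rule cINF_greatest[OF C(1) that])
  show ?thesis
    unfolding gauge_like_def
  proof (intro conjI allI)
    fix s t
    show "(INF p\<in>C. p s) \<le> (INF p\<in>C. p (s * t))"
    proof (rule ge)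
      fix p assume "p \<in> C"
      then show "(INF p\<in>C. p s) \<le> p (s * t)"
        using le[of p s] gauge_likeD(1)[OF C(2), of p s t] by linarith
    qed
    have *: "(INF p\<in>C. p (s * t)) \<le> p s + q t" if pq: "p \<in> C" "q \<in> C" for p q
    proof -
      obtain r where r: "r \<in> C" "r \<le> p" "r \<le> q"
        using chain[OF pq] pq by blast
      have "(INF p\<in>C. p (s * t)) \<le> r s + r t"
        using le[OF r(1), of "s * t"] gauge_likeD(2)[OF C(2)[OF r(1)], of s t] by linarith
      then show ?thesis
        using r(2,3) by (meson add_mono le_funD order_trans)
    qed
    have "(INF p\<in>C. p (s * t)) - p s \<le> (INF p\<in>C. p t)" if "p \<in> C" for p
      using *[OF that] by (intro ge) (simp add: algebra_simps)
    then have "(INF p\<in>C. p (s * t)) - (INF p\<in>C. p t) \<le> (INF p\<in>C. p s)"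
      by (intro ge) (simp add: algebra_simps)
    then show "(INF p\<in>C. p (s * t)) \<le> (INF p\<in>C. p s) + (INF p\<in>C. p t)"
      by simp
  next
    fix s n
    show "(INF p\<in>C. p (s ^ n)) = real n * (INF p\<in>C. p s)"
    proof (cases "n = 0")
      case True
      then have "(INF p\<in>C. p (s ^ n)) = (INF p\<in>C. 0)"
        using gauge_like_1[OF C(2)] by (intro INF_cong) auto
      then show ?thesis using True C(1) by simp
    next
      case False
      then have n: "0 < real n" by simp
      have hom: "p (s ^ n) = real n * p s" if "p \<in> C" for p
        using gauge_likeD(3)[OF C(2)[OF that]] .
      have "(INF p\<in>C. p (s ^ n)) / real n \<le> (INF p\<in>C. p s)"
      proof (rule ge)
        fix p assume "p \<in> C"
        then show "(INF p\<in>C. p (s ^ n)) / real n \<le> p s"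
          using le[of p "s ^ n"] hom[of p] n by (simp add: divide_le_eq mult.commute)
      qed
      moreover have "real n * (INF p\<in>C. p s) \<le> (INF p\<in>C. p (s ^ n))"
        using le[of _ s] n by (intro ge) (simp add: hom)
      ultimately show ?thesis
        using n by (simp add: field_simps)
    qed
  next
    fix s
    have unit: "p (s * a) = p s + 1" if "p \<in> C" for p
      using gauge_likeD(4)[OF C(2)[OF that]] .
    have "(INF p\<in>C. p (s * a)) - 1 \<le> (INF p\<in>C. p s)"
    proof (rule ge)
      fix p assume "p \<in> C"
      then show "(INF p\<in>C. p (s * a)) - 1 \<le> p s"
        using le[of p "s * a"] unit[of p] by linarith
    qed
    moreover have "(INF p\<in>C. p s) + 1 \<le> (INF p\<in>C. p (s * a))"
      using le[of _ s] by (intro ge) (simp add: unit)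
    ultimately show "(INF p\<in>C. p (s * a)) = (INF p\<in>C. p s) + 1"
      by simp
  qed
qed

text \<open>The one-step modification of the Hahn-Banach argument: \<open>q\<close> lowers
  \<open>p\<close> as far as the direction \<open>y\<close> permits. If \<open>p\<close> is minimal,
  then \<open>q = p\<close>, and the last inequality becomes superadditivity of
  \<open>p\<close>.\<close>

lemma gauge_like_improve:
  fixes p :: "'a::comm_monoid_mult \<Rightarrow> real" and y :: 'a
  assumes p: "gauge_like a p"
  defines "q \<equiv> \<lambda>x. INF n. p (x * y ^ n) - real n * p y"
  shows "gauge_like a q" "q x \<le> p x" "q x \<le> p (x * y) - p y"
proof -
  note D = gauge_likeD[OF p]
  \<comment> \<open>Monotonicity and homogeneity give
    \<open>p (x * y ^ n) \<ge> p (y ^ n) = real n * p y\<close>, so the infimum exists and is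
    nonnegative.\<close>
  have lower: "0 \<le> p (x * y ^ n) - real n * p y" for x n
    using D(1)[of "y ^ n" x] D(3)[of y n] by (simp add: mult.commute)
  have bdd: "bdd_below (range (\<lambda>n. p (x * y ^ n) - real n * p y))" for x
    using lower by (intro bdd_belowI2[of _ 0])
  have le: "q x \<le> p (x * y ^ n) - real n * p y" for x n
    unfolding q_def by (rule cINF_lower[OF bdd]) simp
  have ge: "c \<le> q x" if "\<And>n. c \<le> p (x * y ^ n) - real n * p y" for c x
    unfolding q_def by (rule cINF_greatest[OF _ that]) simp
  have sub: "q (s * t) \<le> q s + q t" for s t
  proof -
    have *: "q (s * t) \<le> (p (s * y ^ m) - real m * p y) + (p (t * y ^ n) - real n * p y)" for m n
      using le[of "s * t" "m + n"] D(2)[of "s * y ^ m" "t * y ^ n"]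
      by (simp add: power_add ac_simps algebra_simps)
    have "q (s * t) - (p (s * y ^ m) - real m * p y) \<le> q t" for m
      using *[of m] by (intro ge) (simp add: algebra_simps)
    then have "q (s * t) - q t \<le> q s"
      by (intro ge) (simp add: algebra_simps)
    then show ?thesis by simp
  qed
  have q1: "q 1 = 0"
  proof (rule antisym)
    show "q 1 \<le> 0" using le[of 1 0] gauge_like_1[OF p] by simp
    show "0 \<le> q 1" by (rule ge[OF lower])
  qed
  have pow_le: "q (s ^ n) \<le> real n * q s" for s n
  proof (induction n)
    case (Suc n)
    then show ?case using sub[of s "s ^ n"] by (simp add: algebra_simps)
  qed (simp add: q1)
  have pow_ge: "real k * q s \<le> q (s ^ k)" for s k
  proof (cases "k = 0")
    case False
    show ?thesis
    proof (rule ge)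
      fix n
      \<comment> \<open>The terms of the infimum decrease in \<open>n\<close>, so only the multiples of \<open>k\<close> matter.\<close>
      have "real k * q s \<le> real k * (p (s * y ^ n) - real n * p y)"
        using le[of s n] by (intro mult_left_mono) auto
      also have "\<dots> = p (s ^ k * y ^ (n * k)) - real (n * k) * p y"
        using D(3)[of "s * y ^ n" k]
        by (simp add: power_mult_distrib algebra_simps flip: power_mult)
      also have "\<dots> \<le> p (s ^ k * y ^ n) + p (y ^ (n * k - n)) - real (n * k) * p y"
      proof -
        have "n \<le> n * k" using False by simp
        then have "s ^ k * y ^ (n * k) = (s ^ k * y ^ n) * y ^ (n * k - n)"
          by (simp add: mult.assoc flip: power_add)
        then show ?thesis using D(2)[of "s ^ k * y ^ n" "y ^ (n * k - n)"] by simp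
      qed
      also have "\<dots> = p (s ^ k * y ^ n) - real n * p y"
        using False by (simp add: D(3) of_nat_diff algebra_simps)
      finally show "real k * q s \<le> p (s ^ k * y ^ n) - real n * p y" .
    qed
  qed (simp add: q1)
  have unit: "q (s * a) = q s + 1" for s
  proof -
    have eq: "p (s * a * y ^ n) = p (s * y ^ n) + 1" for n
      using D(4)[of "s * y ^ n"] by (simp add: ac_simps)
    have "q (s * a) - 1 \<le> q s"
      by (rule ge) (use le[of "s * a"] eq in \<open>simp add: algebra_simps\<close>)
    moreover have "q s + 1 \<le> q (s * a)"
      by (rule ge) (use le[of s] eq in \<open>simp add: algebra_simps\<close>)
    ultimately show ?thesis by simp
  qed
  have mono: "q s \<le> q (s * t)" for s t
  proof (rule ge)
    fix n
    show "q s \<le> p (s * t * y ^ n) - real n * p y"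
      using le[of s n] D(1)[of "s * y ^ n" t] by (simp add: ac_simps)
  qed
  show "gauge_like a q"
    unfolding gauge_like_def using mono sub pow_le pow_ge unit by (meson antisym)
  show "q x \<le> p x" using le[of x 0] by simp
  show "q x \<le> p (x * y) - p y" using le[of x 1] by simp
qed

lemma additive_functional_exists:
  fixes a :: "'a::comm_monoid_mult"
  assumes cancel: "\<And>a b c :: 'a. a * b = a * c \<Longrightarrow> b = c"
    and arch: "\<And>s. \<exists>n. s dvd a ^ n"
    and nonunit: "\<not> a dvd 1"
  obtains p :: "'a \<Rightarrow> real"
  where "\<And>s. 0 \<le> p s" "\<And>s t. p (s * t) = p s + p t" "p a = 1"
proof -
  let ?A = "{p. gauge_like a p}"
  have "\<exists>m\<in>?A. \<forall>q\<in>?A. q \<le> m \<longrightarrow> q = m"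
  \<comment> \<open>The order is reversed, so that a maximal element is a minimal functional and
    upper bounds of chains are infima.\<close>
  proof (rule predicate_Zorn)
    show "partial_order_on ?A (relation_of (\<lambda>p q. q \<le> p) ?A)"
      by (rule partial_order_on_relation_ofI) auto
    fix C assume C: "C \<in> Chains (relation_of (\<lambda>p q. q \<le> p) ?A)"
    then have sub: "C \<subseteq> ?A" and chain: "\<And>p q. p \<in> C \<Longrightarrow> q \<in> C \<Longrightarrow> p \<le> q \<or> q \<le> p"
      unfolding Chains_def relation_of_def by blast+
    show "\<exists>u\<in>?A. \<forall>p\<in>C. u \<le> p"
    proof (cases "C = {}")
      case True
      then show ?thesis using gauge_like_exists[OF assms] by auto
    next
      case False
      have "bdd_below ((\<lambda>p. p s) ` C)" for s
        using sub gauge_like_nonneg by (intro bdd_belowI2[of _ 0]) blast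
      then have "\<forall>p\<in>C. (\<lambda>s. INF p\<in>C. p s) \<le> p"
        by (auto intro!: le_funI cINF_lower)
      moreover have "gauge_like a (\<lambda>s. INF p\<in>C. p s)"
        using False sub chain by (intro gauge_like_Inf_chain) auto
      ultimately show ?thesis by blast
    qed
  qed
  then obtain p where p: "gauge_like a p" and min: "\<And>q. gauge_like a q \<Longrightarrow> q \<le> p \<Longrightarrow> q = p"
    by blast
  have "p (s * t) = p s + p t" for s t
  proof (rule antisym)
    show "p (s * t) \<le> p s + p t" by (rule gauge_likeD(2)[OF p])
    \<comment> \<open>By minimality the modification in the direction \<open>t\<close> changes
      nothing.\<close>
    have "(\<lambda>x. INF n. p (x * t ^ n) - real n * p t) = p"
      by (intro min le_funI gauge_like_improve[OF p])
    from fun_cong[OF this, of s] show "p s + p t \<le> p (s * t)"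
      using gauge_like_improve(3)[OF p, of s t] by linarith
  qed
  moreover have "p a = 1"
    using gauge_likeD(4)[OF p, of 1] gauge_like_1[OF p] by simp
  ultimately show thesis
    using that gauge_like_nonneg[OF p] by blast
qed

section \<open>Semicharacters and the algebra\<close>

text \<open>A multiplicative function that is not identically zero takes the value 1 at the unit.
  This turns the open condition of not vanishing identically into a closed one, as compactness
  requires.\<close>

lemma semicharacters_eq:
  "semicharacters = {\<psi> :: 'a::comm_monoid_mult \<Rightarrow> complex.
    \<psi> 1 = 1 \<and> (\<forall>s t. \<psi> (s * t) = \<psi> s * \<psi> t) \<and> (\<forall>s. cmod (\<psi> s) \<le> 1)}"
proof -
  have "\<psi> 1 = 1" if "\<forall>s t. \<psi> (s * t) = \<psi> s * \<psi> t" "\<psi> s \<noteq> 0" for \<psi> :: "'a \<Rightarrow> complex" and s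
    using that(1)[rule_format, of s 1] that(2) by simp
  moreover have "\<exists>s. \<psi> s \<noteq> 0" if "\<psi> 1 = 1" for \<psi> :: "'a \<Rightarrow> complex"
    using that by (intro exI[of _ 1]) simp
  ultimately show ?thesis
    unfolding semicharacters_def by auto
qed

lemma semicharactersD:
  assumes "\<psi> \<in> semicharacters"
  shows "\<psi> 1 = 1" "\<psi> (s * t) = \<psi> s * \<psi> t" "cmod (\<psi> s) \<le> 1"
  using assms unfolding semicharacters_eq by auto

lemma semicharactersI:
  assumes "\<psi> 1 = 1" "\<And>s t. \<psi> (s * t) = \<psi> s * \<psi> t" "\<And>s. cmod (\<psi> s) \<le> 1"
  shows "\<psi> \<in> semicharacters"
  using assms unfolding semicharacters_eq by auto

lemma continuous_on_evaluation [continuous_intros]: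
  "continuous_on S (\<lambda>\<psi> :: 'a \<Rightarrow> complex. \<psi> s)"
  by (rule continuous_on_product_then_coordinatewise) (rule continuous_on_id)

text \<open>The semicharacters are cut out by closed conditions from a product of closed discs,
  which is compact by Tychonoff's theorem.\<close>

lemma compact_semicharacters:
  "compact (semicharacters :: ('a::comm_monoid_mult \<Rightarrow> complex) set)"
  and closed_semicharacters: "closed (semicharacters :: ('a \<Rightarrow> complex) set)"
proof -
  let ?K = "PiE UNIV (\<lambda>_. cball 0 1) :: ('a \<Rightarrow> complex) set"
  let ?H = "{\<psi> :: 'a \<Rightarrow> complex. \<psi> 1 = 1} \<inter> (\<Inter>s. \<Inter>t. {\<psi>. \<psi> (s * t) = \<psi> s * \<psi> t})"
  have "compactin (product_topology (\<lambda>_. euclidean) UNIV) ?K"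
    unfolding compactin_PiE by simp
  then have K: "compact ?K"
    by (simp add: euclidean_product_topology)
  have H: "closed ?H"
    by (intro closed_Int closed_INT ballI closed_Collect_eq continuous_intros)
  have eq: "semicharacters = ?H \<inter> ?K"
    unfolding semicharacters_eq by (auto simp: PiE_UNIV_domain)
  have "closed ((\<Inter>s. {\<psi> :: 'a \<Rightarrow> complex. cmod (\<psi> s) \<le> 1}))"
    by (intro closed_INT ballI closed_Collect_le continuous_intros)
  moreover have "?K = (\<Inter>s. {\<psi>. cmod (\<psi> s) \<le> 1})"
    by (auto simp: PiE_UNIV_domain)
  ultimately show "closed (semicharacters :: ('a \<Rightarrow> complex) set)"
    unfolding eq using H by (simp only: closed_Int)
  show "compact (semicharacters :: ('a \<Rightarrow> complex) set)"
    unfolding eq by (rule closed_Int_compact[OF H K])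
qed

lemma closedin_characters:
  "closedin (top_of_set semicharacters) (characters :: ('a::comm_monoid_mult \<Rightarrow> complex) set)"
proof -
  have "closed (\<Inter>s. {\<psi> :: 'a \<Rightarrow> complex. cmod (\<psi> s) = 1})"
    by (intro closed_INT ballI closed_Collect_eq continuous_intros)
  moreover have "characters = semicharacters \<inter> (\<Inter>s. {\<psi> :: 'a \<Rightarrow> complex. cmod (\<psi> s) = 1})"
    unfolding characters_def by auto
  ultimately show ?thesis
    by (metis closedin_closed_Int)
qed

section \<open>Closure properties of the algebra and its peak functions\<close>

lemma A_hat_mult:
  assumes "F \<in> A_hat" "G \<in> A_hat"
  shows "(\<lambda>\<psi>. F \<psi> * G \<psi>) \<in> A_hat"
  using assms unfolding A_hat_def generalized_analytic_def
  by (auto intro!: continuous_on_mult analytic_on_mult tendsto_mult)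

text \<open>In \<open>z\<close> the path is an exponential if \<open>\<rho> s \<noteq> 0\<close>;
  otherwise it is constant, the value at \<open>z = 0\<close> included, because
  \<open>0 powr z = 0\<close>. These functions supply the constants and all peaking functions
  needed.\<close>

lemma A_hat_affine: "(\<lambda>\<psi>. c + d * \<psi> s) \<in> A_hat"
proof -
  have "(\<lambda>z. c + d * (semichar_power \<rho> z s * \<psi> s)) analytic_on {z. 0 < Re z}
      \<and> ((\<lambda>z. c + d * (semichar_power \<rho> z s * \<psi> s))
          \<longlongrightarrow> c + d * (semichar_power \<rho> 0 s * \<psi> s)) (at 0 within {z. 0 < Re z})"
    for \<rho> \<psi> :: "'a \<Rightarrow> complex"
  proof (cases "\<rho> s = 0")
    case True
    then show ?thesis by (simp add: semichar_power_def)
  next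
    case False
    then have "(\<lambda>z. semichar_power \<rho> z s) = (\<lambda>z. exp (z * Ln (\<rho> s)))"
      by (simp add: semichar_power_def powr_def)
    then show ?thesis
      using False by (auto simp: semichar_power_0 fun_eq_iff intro!: analytic_intros tendsto_eq_intros)
  qed
  moreover have "continuous_on semicharacters (\<lambda>\<psi>. c + d * \<psi> s)"
    by (intro continuous_intros)
  ultimately show ?thesis
    unfolding A_hat_def generalized_analytic_def by blast
qed

lemma A_hat_one: "(\<lambda>_. 1) \<in> A_hat"
  using A_hat_affine[of 1 0] by simp

lemma A_hat_continuous: "F \<in> A_hat \<Longrightarrow> continuous_on semicharacters F"
  unfolding A_hat_def by blast

lemma norm_one_plus_less_2:
  fixes w :: complex
  assumes "cmod w \<le> 1" "w \<noteq> 1"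
  shows "cmod (1 + w) < 2"
proof -
  \<comment> \<open>In the closed unit disc real part 1 forces \<open>w = 1\<close>.\<close>
  have "Re w \<noteq> 1"
  proof
    assume "Re w = 1"
    moreover from this have "Im w = 0"
      using assms(1) cmod_power2[of w] power_le_one[OF norm_ge_zero assms(1), of 2] by simp
    ultimately show False using assms(2) by (simp add: complex_eq_iff)
  qed
  then have "Re w < 1"
    using complex_Re_le_cmod[of w] assms(1) by simp
  moreover have "(cmod (1 + w))\<^sup>2 = 1 + 2 * Re w + (cmod w)\<^sup>2"
    unfolding cmod_power2 by (simp add: power2_eq_square algebra_simps)
  moreover have "(cmod w)\<^sup>2 \<le> 1"
    using assms(1) by (simp add: power_le_one)
  ultimately have "(cmod (1 + w))\<^sup>2 < 2\<^sup>2"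
    by simp
  then show ?thesis
    by (rule power2_less_imp_less) simp
qed

lemma characters_subset_strong_boundary: "characters \<subseteq> strong_boundary A_hat semicharacters"
proof
  fix \<kappa> :: "'a \<Rightarrow> complex"
  assume \<kappa>: "\<kappa> \<in> characters"
  then have semi: "\<kappa> \<in> semicharacters" and norm: "cmod (\<kappa> s) = 1" for s
    unfolding characters_def by auto
  define E where "E s = {\<psi> \<in> semicharacters. \<psi> s = \<kappa> s}" for s
  have "peak_set A_hat semicharacters (E s)" for s
    unfolding peak_set_def
  \<comment> \<open>This is \<open>(1 + cnj (\<kappa> s) * \<psi> s) / 2\<close>, written so that
    its membership in the algebra is an instance of \<open>A_hat_affine\<close>.\<close>
  proof (intro conjI bexI[where x = "\<lambda>\<psi>. 1 / 2 + cnj (\<kappa> s) / 2 * \<psi> s"] ballI)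
    show "E s \<noteq> {}" "E s \<subseteq> semicharacters"
      using semi unfolding E_def by auto
    show "(\<lambda>\<psi>. 1 / 2 + cnj (\<kappa> s) / 2 * \<psi> s) \<in> A_hat"
      by (rule A_hat_affine)
    have unit: "cnj (\<kappa> s) * \<kappa> s = 1"
      using norm[of s] by (simp add: complex_norm_square[symmetric] mult.commute)
    fix \<psi>
    show "1 / 2 + cnj (\<kappa> s) / 2 * \<psi> s = 1" if "\<psi> \<in> E s"
      using that unit unfolding E_def by simp
    assume \<psi>: "\<psi> \<in> semicharacters - E s"
    have "cnj (\<kappa> s) * \<psi> s \<noteq> 1"
    proof
      assume "cnj (\<kappa> s) * \<psi> s = 1"
      then have "cnj (\<kappa> s) * \<psi> s = cnj (\<kappa> s) * \<kappa> s" using unit by simp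
      then show False using \<psi> norm[of s] unfolding E_def by auto
    qed
    moreover have "cmod (cnj (\<kappa> s) * \<psi> s) \<le> 1"
      using semicharactersD(3)[of \<psi> s] \<psi> norm[of s] by (simp add: norm_mult)
    ultimately have "cmod (1 + cnj (\<kappa> s) * \<psi> s) < 2"
      by (intro norm_one_plus_less_2)
    then have "cmod ((1 + cnj (\<kappa> s) * \<psi> s) / 2) < 1"
      by (simp add: norm_divide)
    then show "cmod (1 / 2 + cnj (\<kappa> s) / 2 * \<psi> s) < 1"
      by (simp add: add_divide_distrib)
  qed
  moreover have "(\<Inter>s. E s) = {\<kappa>}"
    using semi unfolding E_def by auto
  ultimately have "p_point A_hat semicharacters \<kappa>"
    unfolding p_point_def by (intro exI[of _ "range E"]) auto
  then show "\<kappa> \<in> strong_boundary A_hat semicharacters"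
    unfolding strong_boundary_def using semi by blast
qed

section \<open>The characters form a boundary\<close>

text \<open>The path \<open>\<phi> z\<close> passes through \<open>\<psi>\<close> at
  \<open>z = 1\<close> and runs through characters on the imaginary axis. The half-plane maximum
  principle thus carries the bound from the characters to \<open>\<psi>\<close>.\<close>

lemma nonvanishing_semicharacter_bound:
  fixes F :: "('a::comm_monoid_mult \<Rightarrow> complex) \<Rightarrow> complex"
  assumes F: "F \<in> A_hat"
    and bound: "\<And>\<kappa>. \<kappa> \<in> characters \<Longrightarrow> cmod (F \<kappa>) \<le> m"
    and \<psi>: "\<psi> \<in> semicharacters" "\<And>s. \<psi> s \<noteq> 0"
  shows "cmod (F \<psi>) \<le> m"
proof (cases "\<psi> \<in> characters")
  case True
  then show ?thesis by (rule bound)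
next
  case False
  define \<rho> where "\<rho> s = complex_of_real (cmod (\<psi> s))" for s
  define \<phi> where "\<phi> z = (\<lambda>s. \<rho> s powr z * sgn (\<psi> s))" for z
  have \<rho>0: "\<rho> s \<noteq> 0" for s
    using \<psi>(2) unfolding \<rho>_def by simp
  have \<rho>_mult: "\<rho> (s * t) = \<rho> s * \<rho> t" for s t
    unfolding \<rho>_def by (simp add: semicharactersD(2)[OF \<psi>(1)] norm_mult)
  have \<rho>_semi: "\<rho> \<in> semicharacters"
    using semicharactersD[OF \<psi>(1)] \<rho>_mult by (intro semicharactersI) (auto simp: \<rho>_def)
  have norm_\<phi>: "cmod (\<phi> z s) = cmod (\<psi> s) powr Re z" for z s
    using \<psi>(2)[of s] unfolding \<phi>_def \<rho>_def
    by (simp add: norm_mult norm_sgn norm_powr_real_powr)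
  have \<phi>_semi: "\<phi> z \<in> semicharacters" if "0 \<le> Re z" for z
  proof (rule semicharactersI)
    show "\<phi> z 1 = 1"
      unfolding \<phi>_def \<rho>_def by (simp add: semicharactersD(1)[OF \<psi>(1)])
    show "\<phi> z (s * t) = \<phi> z s * \<phi> z t" for s t
    proof -
      have "\<rho> (s * t) powr z = \<rho> s powr z * \<rho> t powr z"
        unfolding \<rho>_mult by (rule powr_times_real_left) (auto simp: \<rho>_def)
      then show ?thesis
        unfolding \<phi>_def by (simp add: semicharactersD(2)[OF \<psi>(1)] sgn_mult)
    qed
    show "cmod (\<phi> z s) \<le> 1" for s
      unfolding norm_\<phi> using that semicharactersD(3)[OF \<psi>(1)] by (intro powr_le1) auto
  qed
  have \<phi>_char: "\<phi> z \<in> characters" if "Re z = 0" for z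
    using \<phi>_semi[of z] that \<psi>(2) unfolding characters_def by (simp add: norm_\<phi>)
  have \<phi>_1: "\<phi> 1 = \<psi>"
  proof
    fix s
    show "\<phi> 1 s = \<psi> s"
      using \<psi>(2)[of s] unfolding \<phi>_def \<rho>_def by (simp add: sgn_div_norm scaleR_conv_of_real)
  qed
  \<comment> \<open>The point \<open>s0\<close> keeps the whole path over the open half-plane away
    from the characters, where generalized analyticity gives information.\<close>
  obtain s0 where "cmod (\<psi> s0) \<noteq> 1"
    using False \<psi>(1) unfolding characters_def by blast
  then have s0: "cmod (\<psi> s0) < 1" "0 < cmod (\<psi> s0)"
    using semicharactersD(3)[OF \<psi>(1), of s0] \<psi>(2)[of s0] by auto
  have \<phi>_not_char: "\<phi> z \<notin> characters" if "0 < Re z" for z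
  proof -
    have "cmod (\<psi> s0) powr Re z < 1"
      using powr_less_mono2[OF that _ s0(1)] by simp
    then have "cmod (\<phi> z s0) \<noteq> 1"
      unfolding norm_\<phi> by simp
    then show ?thesis
      unfolding characters_def by blast
  qed
  have \<rho>_nonneg: "nonneg_semicharacter \<rho>"
    unfolding nonneg_semicharacter_def using \<rho>_semi by (simp add: \<rho>_def)
  have \<rho>_not_char: "\<rho> \<in> semicharacters - characters"
    using \<rho>_semi False \<psi>(1) unfolding characters_def \<rho>_def by simp
  have hol: "(\<lambda>z. F (\<phi> z)) holomorphic_on {z. 0 < Re z}"
  proof (unfold holomorphic_on_def, intro ballI)
    fix w :: complex assume "w \<in> {z. 0 < Re z}"
    \<comment> \<open>Generalized analyticity is only available along \<open>\<rho>\<^sup>z \<psi>\<close> with \<open>\<psi>\<close> not a character, so the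
      path is started at \<open>\<phi> \<epsilon>\<close> rather than at the character \<open>\<phi> 0\<close>.\<close>
    define \<epsilon> where "\<epsilon> = complex_of_real (Re w / 2)"
    have \<epsilon>: "0 < Re \<epsilon>" "0 < Re (w - \<epsilon>)"
      using \<open>w \<in> _\<close> by (simp_all add: \<epsilon>_def)
    let ?G = "\<lambda>z. F (\<lambda>s. semichar_power \<rho> z s * \<phi> \<epsilon> s)"
    have "\<phi> \<epsilon> \<in> semicharacters - characters"
      using \<phi>_semi[of \<epsilon>] \<phi>_not_char[of \<epsilon>] \<epsilon>(1) by simp
    then have "?G analytic_on {z. 0 < Re z}"
      using F \<rho>_not_char \<rho>_nonneg unfolding A_hat_def generalized_analytic_def by blast
    then have "?G field_differentiable at (w - \<epsilon>)"
      using \<epsilon>(2) analytic_on_imp_differentiable_at by blast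
    then have "(?G \<circ> (\<lambda>z. z - \<epsilon>)) field_differentiable at w"
      by (intro field_differentiable_compose derivative_intros) auto
    moreover have "?G \<circ> (\<lambda>z. z - \<epsilon>) = (\<lambda>z. F (\<phi> z))"
    proof
      fix z
      have "semichar_power \<rho> (z - \<epsilon>) s * \<phi> \<epsilon> s = \<phi> z s" for s
        using powr_add[of "\<rho> s" "z - \<epsilon>" \<epsilon>] by (simp add: semichar_power_def \<phi>_def)
      then show "(?G \<circ> (\<lambda>z. z - \<epsilon>)) z = F (\<phi> z)"
        by simp
    qed
    ultimately show "(\<lambda>z. F (\<phi> z)) field_differentiable at w within {z. 0 < Re z}"
      by (metis field_differentiable_at_within)
  qed
  \<comment> \<open>Each coordinate is continuous up to the imaginary axis, which suffices in the
    product topology; continuity of \<open>F\<close> on all semicharacters then gives continuity of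
    the composite.\<close>
  have "continuous_on {z. 0 \<le> Re z} \<phi>"
    unfolding \<phi>_def using \<rho>0
    by (intro continuous_on_coordinatewise_then_product) (auto simp: powr_def intro!: continuous_intros)
  then have cont: "continuous_on {z. 0 \<le> Re z} (\<lambda>z. F (\<phi> z))"
    using \<phi>_semi by (intro continuous_on_compose2[OF A_hat_continuous[OF F]]) auto
  have "bounded (F ` semicharacters)"
    using compact_continuous_image[OF A_hat_continuous[OF F] compact_semicharacters]
    by (rule compact_imp_bounded)
  then obtain B where B: "\<And>\<psi>. \<psi> \<in> semicharacters \<Longrightarrow> cmod (F \<psi>) \<le> B"
    unfolding bounded_iff by blast
  have "cmod (F (\<phi> 1)) \<le> m"
    by (rule halfplane_maximum_principle[OF hol cont]) (auto intro: B \<phi>_semi bound \<phi>_char)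
  then show ?thesis
    by (simp only: \<phi>_1)
qed

section \<open>Consequences of the absence of nontrivial prime ideals\<close>

text \<open>The complement of such a set is empty or a prime ideal. This is applied to the nonzero
  set of a semicharacter, to the divisors of the powers of \<open>a\<close>, and to the zero set of
  an additive functional.\<close>

lemma divisor_closed_trivial:
  fixes T :: "'a::comm_monoid_mult set"
  assumes no_prime: "\<not> (\<exists>I :: 'a set. nontrivial_prime_ideal I)"
    and T: "1 \<in> T" "\<And>s t. s * t \<in> T \<longleftrightarrow> s \<in> T \<and> t \<in> T"
  shows "T = {1} \<or> T = UNIV"
proof (cases "T = UNIV")
  case False
  then have "prime_ideal (- T)"
    unfolding prime_ideal_def semigroup_ideal_def subsemigroup_def using T by auto
  then have "- T = UNIV - {1}"
    using no_prime unfolding nontrivial_prime_ideal_def by blast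
  then show ?thesis by auto
qed simp

lemma semicharacter_nonvanishing_or_indicator:
  fixes \<psi> :: "'a::comm_monoid_mult \<Rightarrow> complex"
  assumes no_prime: "\<not> (\<exists>I :: 'a set. nontrivial_prime_ideal I)"
    and \<psi>: "\<psi> \<in> semicharacters"
  shows "(\<forall>s. \<psi> s \<noteq> 0) \<or> \<psi> = (\<lambda>s. if s = 1 then 1 else 0)"
proof -
  have "{s. \<psi> s \<noteq> 0} = {1} \<or> {s. \<psi> s \<noteq> 0} = UNIV"
    by (rule divisor_closed_trivial[OF no_prime]) (simp_all add: semicharactersD[OF \<psi>])
  then show ?thesis
  proof
    assume "{s. \<psi> s \<noteq> 0} = {1}"
    then have "\<psi> = (\<lambda>s. if s = 1 then 1 else 0)"
      using semicharactersD(1)[OF \<psi>] by (auto simp: fun_eq_iff)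
    then show ?thesis ..
  qed blast
qed

lemma indicator_one_limit:
  fixes a :: "'a::comm_monoid_mult"
  assumes cancel: "\<And>a b c :: 'a. a * b = a * c \<Longrightarrow> b = c"
    and no_prime: "\<not> (\<exists>I :: 'a set. nontrivial_prime_ideal I)"
    and semi: "(\<lambda>s :: 'a. if s = 1 then 1 else 0) \<in> semicharacters"
    and a: "a \<noteq> 1"
  obtains \<psi> :: "nat \<Rightarrow> 'a \<Rightarrow> complex"
  where "\<And>n. \<psi> n \<in> semicharacters" "\<And>n s. \<psi> n s \<noteq> 0"
    "\<psi> \<longlonglongrightarrow> (\<lambda>s. if s = 1 then 1 else 0)"
proof -
  \<comment> \<open>If \<open>a * b = 1\<close>, multiplicativity of the indicator would give
    \<open>1 = 0\<close> because it vanishes at \<open>a\<close>.\<close>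
  have nonunit: "\<not> a dvd 1"
  proof
    assume "a dvd 1"
    then obtain b where "a * b = 1" by (metis dvdE)
    then show False
      using semicharactersD(2)[OF semi, of a b] a by simp
  qed
  have "{s. \<exists>n. s dvd a ^ n} = {1} \<or> {s. \<exists>n. s dvd a ^ n} = UNIV"
  proof (rule divisor_closed_trivial[OF no_prime])
    show "1 \<in> {s. \<exists>n. s dvd a ^ n}" by auto
    have "s * t dvd a ^ (m + n)" if "s dvd a ^ m" "t dvd a ^ n" for s t m n
      using that by (simp add: power_add mult_dvd_mono)
    then show "s * t \<in> {s. \<exists>n. s dvd a ^ n} \<longleftrightarrow>
        s \<in> {s. \<exists>n. s dvd a ^ n} \<and> t \<in> {s. \<exists>n. s dvd a ^ n}" for s t
      by (auto dest: dvd_mult_left dvd_mult_right) blast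
  qed
  moreover have "a \<in> {s. \<exists>n. s dvd a ^ n}"
    by (auto intro: exI[of _ 1])
  ultimately have arch: "\<exists>n. s dvd a ^ n" for s
    using a by blast
  obtain p :: "'a \<Rightarrow> real" where p: "\<And>s. 0 \<le> p s" "\<And>s t. p (s * t) = p s + p t" "p a = 1"
    by (rule additive_functional_exists[OF _ arch nonunit]) (use cancel in blast)+
  have p1: "p 1 = 0"
    using p(2)[of 1 1] by simp
  \<comment> \<open>A sum of nonnegative numbers vanishes only if both do, so the zero set is
    divisor-closed; \<open>p a = 1\<close> excludes the whole monoid.\<close>
  have "{s. p s = 0} = {1} \<or> {s. p s = 0} = UNIV"
    by (rule divisor_closed_trivial[OF no_prime]) (simp_all add: p1 p(2) add_nonneg_eq_0_iff p(1))
  then have "{s. p s = 0} = {1}"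
    using p(3) by (metis UNIV_I mem_Collect_eq zero_neq_one)
  then have pos: "0 < p s" if "s \<noteq> 1" for s
    using that p(1)[of s] by (metis less_eq_real_def mem_Collect_eq singletonD)
  \<comment> \<open>This is \<open>exp (- n p)\<close>: it stays 1 at the unit and tends to 0
    elsewhere, since \<open>p\<close> is positive there.\<close>
  define \<psi> where "\<psi> n s = complex_of_real (exp (- p s) ^ n)" for n s
  show thesis
  proof
    show "\<psi> n \<in> semicharacters" for n
    proof (rule semicharactersI)
      show "\<psi> n 1 = 1" by (simp add: \<psi>_def p1)
      show "\<psi> n (s * t) = \<psi> n s * \<psi> n t" for s t
        by (simp add: \<psi>_def p(2) exp_add exp_diff exp_minus field_simps)
      show "cmod (\<psi> n s) \<le> 1" for s
        using p(1)[of s] by (simp add: \<psi>_def norm_power power_le_one)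
    qed
    show "\<psi> n s \<noteq> 0" for n s
      by (simp add: \<psi>_def)
    have "(\<lambda>n. \<psi> n s) \<longlonglongrightarrow> (if s = 1 then 1 else 0)" for s
    proof (cases "s = 1")
      case False
      have "(\<lambda>n. exp (- p s) ^ n) \<longlonglongrightarrow> 0"
        using pos[OF False] by (intro LIMSEQ_realpow_zero) auto
      then have "(\<lambda>n. complex_of_real (exp (- p s) ^ n)) \<longlonglongrightarrow> complex_of_real 0"
        by (rule tendsto_of_real)
      then show ?thesis
        using False by (simp add: \<psi>_def)
    qed (simp add: \<psi>_def p1)
    then show "\<psi> \<longlonglongrightarrow> (\<lambda>s. if s = 1 then 1 else 0)"
      using limitin_componentwise[of "\<lambda>_. euclidean" UNIV \<psi> _ sequentially]
      by (simp add: euclidean_product_topology)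
  qed
qed

text \<open>The modulus of \<open>F\<close> has a maximum on the compact set of characters. It
  bounds \<open>F\<close> on nonvanishing semicharacters, and the indicator of the unit, the only
  other candidate, is a limit of those.\<close>

lemma closed_boundary_characters:
  assumes cancel: "\<And>a b c :: 'a::comm_monoid_mult. a * b = a * c \<Longrightarrow> b = c"
    and no_prime: "\<not> (\<exists>I :: 'a set. nontrivial_prime_ideal I)"
  shows "closed_boundary A_hat semicharacters (characters :: ('a \<Rightarrow> complex) set)"
  unfolding closed_boundary_def
proof (intro conjI closedin_characters ballI)
  fix F :: "('a \<Rightarrow> complex) \<Rightarrow> complex"
  assume F: "F \<in> A_hat"
  have "characters \<subseteq> (semicharacters :: ('a \<Rightarrow> complex) set)"
    unfolding characters_def by blast
  then have "continuous_on characters (\<lambda>\<kappa>. cmod (F \<kappa>))"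
    using continuous_on_subset[OF A_hat_continuous[OF F]] by (intro continuous_on_norm)
  moreover have "compact (characters :: ('a \<Rightarrow> complex) set)"
    using closedin_compact[OF compact_semicharacters closedin_characters] .
  moreover have "(\<lambda>_ :: 'a. 1) \<in> characters"
    unfolding characters_def by (auto intro: semicharactersI)
  ultimately obtain \<kappa> where \<kappa>: "\<kappa> \<in> characters"
      "\<And>\<psi>. \<psi> \<in> characters \<Longrightarrow> cmod (F \<psi>) \<le> cmod (F \<kappa>)"
    using continuous_attains_sup[of characters "\<lambda>\<kappa>. cmod (F \<kappa>)"] by blast
  note nonvanishing = nonvanishing_semicharacter_bound[OF F \<kappa>(2)]
  have "cmod (F \<psi>) \<le> cmod (F \<kappa>)" if \<psi>: "\<psi> \<in> semicharacters" for \<psi>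
  proof (cases "\<forall>s. \<psi> s \<noteq> 0")
    case True
    then show ?thesis using nonvanishing \<psi> by blast
  next
    case False
    then have eq: "\<psi> = (\<lambda>s. if s = 1 then 1 else 0)"
      using semicharacter_nonvanishing_or_indicator[OF no_prime \<psi>] by blast
    moreover obtain a where "\<psi> a = 0"
      using False by blast
    ultimately have a: "a \<noteq> 1" by auto
    obtain \<psi>' :: "nat \<Rightarrow> 'a \<Rightarrow> complex"
      where \<psi>': "\<And>n. \<psi>' n \<in> semicharacters" "\<And>n s. \<psi>' n s \<noteq> 0" "\<psi>' \<longlonglongrightarrow> \<psi>"
      by (rule indicator_one_limit[OF _ no_prime \<psi>[unfolded eq] a]) (use cancel eq in blast)+
    have "(\<lambda>n. F (\<psi>' n)) \<longlonglongrightarrow> F \<psi>"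
      using continuous_on_tendsto_compose[OF A_hat_continuous[OF F] \<psi>'(3) \<psi>] \<psi>'(1) by simp
    then show ?thesis
      using nonvanishing \<psi>'(1,2) by (intro Lim_bounded[OF tendsto_norm]) auto
  qed
  then show "\<exists>\<kappa>\<in>characters. \<forall>\<psi>\<in>semicharacters. cmod (F \<psi>) \<le> cmod (F \<kappa>)"
    using \<kappa>(1) by blast
qed

theorem mainTheorem4:
  assumes cancel: "\<And>a b c :: 'a::comm_monoid_mult. a * b = a * c \<Longrightarrow> b = c"
    and no_prime: "\<not> (\<exists>I :: 'a set. nontrivial_prime_ideal I)"
  shows "strong_boundary (A_hat :: (('a \<Rightarrow> complex) \<Rightarrow> complex) set) semicharacters = characters \<and>
    is_shilov_boundary (A_hat :: (('a \<Rightarrow> complex) \<Rightarrow> complex) set) semicharacters characters"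
proof -
  let ?A = "A_hat :: (('a \<Rightarrow> complex) \<Rightarrow> complex) set"
  have X: "closed_boundary ?A semicharacters characters"
    by (rule closed_boundary_characters[OF assms])
  \<comment> \<open>With the characters as \<open>E\<close> this bounds the strong boundary from
    above; with arbitrary \<open>E\<close> it gives minimality of the characters among closed
    boundaries.\<close>
  have sub: "strong_boundary ?A semicharacters \<subseteq> E" if "closed_boundary ?A semicharacters E" for E
    using compact_semicharacters closed_semicharacters A_hat_continuous A_hat_one A_hat_mult that
    by (rule strong_boundary_subset_closed_boundary)
  have "strong_boundary ?A semicharacters = characters"
    using sub[OF X] characters_subset_strong_boundary by blast
  then show ?thesis
    unfolding is_shilov_boundary_def using X sub by simp
qed

end
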